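(* Let $f,g:\mathbb{R}\to\mathbb{R}$ be continuous odd functions such that $xf(x)>0$ and $xg(x)>0$ for all $x\in\mathbb{R}\setminus\{0\}$, and $f(0)=g(0)=0$. Consider the distributed delay differential equation $$x'(t)=-g\left(\int_0^1 f(x(t-s))\,ds\right)\qquad(\mathrm{D})$$ and the planar Hamiltonian system $$x'(t)=-g(y(t)),\qquad y'(t)=2f(x(t)).\qquad(\mathrm{H})$$ Then the following statements are true. (1) If $x:\mathbb{R}\to\mathbb{R}$ is a special symmetric periodic solution (SSPS) of (D), then $$(x(t),y(t))=\left(x(t),\int_0^1 f(x(t-s))\,ds\right)$$ is a periodic solution in $\mathbb{R}^2$ of (H) with minimal period $2$. (2) If $\{(x(t),y(t)):t\in\mathbb{R}\}\subset\mathbb{R}^2$ is a closed orbit of (H) around the origin with minimal period $2$, then $x:\mathbb{R}\to\mathbb{R}$ is an SSPS of (D). Thus (D) has an SSPS if and only if (H) has a closed orbit in $\mathbb{R}^2$ with minimal period $2$.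
   Context: A solution $x:\mathbb{R}\to\mathbb{R}$ of (D) is a differentiable function satisfying (D) for all $t\in\mathbb{R}$. A special symmetric periodic solution (SSPS) of (D) is a solution $x:\mathbb{R}\to\mathbb{R}$ of (D) that is periodic with minimal period $2$ and satisfies $x(t)+x(t-1)=0$ for all $t\in\mathbb{R}$. A closed orbit of (H) with minimal period $2$ is the trajectory of a (nonconstant) periodic solution $(x(t),y(t))$, $t\in\mathbb{R}$, of (H) whose minimal period is $2$. *)

theory Defs
  imports "HOL-Analysis.Analysis"
begin

(* Excludes constant functions, since these have every q > 0 as a period. *)
definition minimal_period :: "(real \<Rightarrow> 'a) \<Rightarrow> real \<Rightarrow> bool" where
  "minimal_period u p \<longleftrightarrow>
     p > 0 \<and> (\<forall>t. u (t + p) = u t) \<and> (\<forall>q. 0 < q \<and> q < p \<longrightarrow> \<not> (\<forall>t. u (t + q) = u t))"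

definition D_solution :: "(real \<Rightarrow> real) \<Rightarrow> (real \<Rightarrow> real) \<Rightarrow> (real \<Rightarrow> real) \<Rightarrow> bool" where
  "D_solution f g x \<longleftrightarrow>
     (\<forall>t. (x has_real_derivative - g (integral {0..1} (\<lambda>s. f (x (t - s))))) (at t))"

definition SSPS :: "(real \<Rightarrow> real) \<Rightarrow> (real \<Rightarrow> real) \<Rightarrow> (real \<Rightarrow> real) \<Rightarrow> bool" where
  "SSPS f g x \<longleftrightarrow> D_solution f g x \<and> minimal_period x 2 \<and> (\<forall>t. x t + x (t - 1) = 0)"

definition H_solution ::
    "(real \<Rightarrow> real) \<Rightarrow> (real \<Rightarrow> real) \<Rightarrow> (real \<Rightarrow> real) \<Rightarrow> (real \<Rightarrow> real) \<Rightarrow> bool" where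
  "H_solution f g x y \<longleftrightarrow>
     (\<forall>t. (x has_real_derivative - g (y t)) (at t) \<and>
          (y has_real_derivative 2 * f (x t)) (at t))"

(* The minimal period is that of the pair (x, y), not of the components. *)
definition H_periodic_solution ::
    "(real \<Rightarrow> real) \<Rightarrow> (real \<Rightarrow> real) \<Rightarrow> real \<Rightarrow> (real \<Rightarrow> real) \<Rightarrow> (real \<Rightarrow> real) \<Rightarrow> bool" where
  "H_periodic_solution f g p x y \<longleftrightarrow>
     H_solution f g x y \<and> minimal_period (\<lambda>t. (x t, y t)) p"

definition trajectory :: "(real \<Rightarrow> real) \<Rightarrow> (real \<Rightarrow> real) \<Rightarrow> (real \<times> real) set" where
  "trajectory x y = range (\<lambda>t. (x t, y t))"

definition H_closed_orbit ::
    "(real \<Rightarrow> real) \<Rightarrow> (real \<Rightarrow> real) \<Rightarrow> real \<Rightarrow> (real \<times> real) set \<Rightarrow> bool" where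
  "H_closed_orbit f g p C \<longleftrightarrow> (\<exists>x y. H_periodic_solution f g p x y \<and> C = trajectory x y)"

(* The origin lies off C, in a bounded component of the complement of C. *)
definition around_origin :: "(real \<times> real) set \<Rightarrow> bool" where
  "around_origin C \<longleftrightarrow> (0, 0) \<in> inside C"

end

theory Submission
  imports Defs
begin

text \<open>
  Both directions rest on one identity, valid whenever \<open>\<Phi>' = f \<circ> x\<close>: the integral of
  \<open>f (x (t - s))\<close> over \<open>0 \<le> s \<le> 1\<close> is \<open>\<Phi> t - \<Phi> (t - 1)\<close>. If \<open>x (t - 1) = - x t\<close>, this
  integral has derivative \<open>f (x t) - f (x (t - 1)) = 2 * f (x t)\<close>, so an SSPS yields a
  solution of the Hamiltonian system. Conversely, for a Hamiltonian solution one may take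
  \<open>\<Phi> = y / 2\<close>, and the integral is \<open>y t\<close> exactly when \<open>y (t - 1) = - y t\<close>. What has to be
  shown is therefore that a solution \<open>z = (x, y)\<close> of minimal period 2 satisfies
  \<open>z (t + 1) = - z t\<close> (\<open>H_periodic_solution_antiperiodic\<close>).

  This symmetry comes from two time-reversing reflections of the system, in the two coordinate
  axes. By Rolle's theorem, \<open>x\<close> vanishes at some time \<open>a\<close> and \<open>y\<close> at some time \<open>b\<close>. The solution
  reflected in the \<open>y\<close>-axis and reversed about time \<open>a\<close> passes through the same point as \<open>z\<close>
  at time \<open>a\<close>, so uniqueness identifies the two; likewise for the \<open>x\<close>-axis and \<open>b\<close>. The two
  reflections compose to \<open>z (t + 2 * (a - b)) = - z t\<close>. Hence \<open>2 * (a - b)\<close> is a half of a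
  multiple of the minimal period, that is an integer. It is odd, since an even one would be a
  period and force \<open>z = 0\<close>; therefore 1 is an antiperiod as well.

  Uniqueness is the delicate point, because \<open>f\<close> and \<open>g\<close> are merely continuous. It holds away
  from the origin (\<open>H_solution_unique\<close>) thanks to the conserved energy \<open>2 * F x + G y\<close>, where
  \<open>F' = f\<close> and \<open>G' = g\<close>. Where \<open>y \<noteq> 0\<close>, the energy determines \<open>y\<close> from \<open>x\<close>, which reduces the
  system to a scalar autonomous equation with nonvanishing right-hand side. Where \<open>x \<noteq> 0\<close>, the
  roles of the variables are exchanged.
\<close>

section \<open>Restoring forces and their potentials\<close>

text \<open>
  Named so because the force \<open>- f\<close> always pulls back towards the equilibrium 0; oddness makes
  it symmetric about that equilibrium.
\<close>
definition restoring :: "(real \<Rightarrow> real) \<Rightarrow> bool" where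
  "restoring f \<longleftrightarrow>
     continuous_on UNIV f \<and> (\<forall>x. f (- x) = - f x) \<and> (\<forall>x. x \<noteq> 0 \<longrightarrow> x * f x > 0)"

lemma restoring_odd: "restoring f \<Longrightarrow> f (- x) = - f x"
  by (simp add: restoring_def)

lemma restoring_eq_0_iff:
  assumes "restoring f"
  shows "f x = 0 \<longleftrightarrow> x = 0"
proof
  assume "f x = 0"
  then show "x = 0"
    using assms unfolding restoring_def by (metis less_irrefl mult_zero_right)
next
  assume "x = 0"
  then show "f x = 0"
    using restoring_odd[OF assms, of 0] by simp
qed

lemma restoring_scale: "restoring f \<Longrightarrow> c > 0 \<Longrightarrow> restoring (\<lambda>x. c * f x)"
  unfolding restoring_def
  by (simp add: continuous_on_mult_left mult.left_commute[of _ c])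

lemma continuous_antiderivative:
  fixes f :: "real \<Rightarrow> real"
  assumes "continuous_on UNIV f"
  obtains F where "\<And>x. (F has_real_derivative f x) (at x)"
proof -
  have "\<exists>F. \<forall>x::real. - \<infinity> < ereal x \<longrightarrow> ereal x < \<infinity> \<longrightarrow> (F has_vector_derivative f x) (at x)"
    using assms
    by (intro einterval_antiderivative) (auto simp: continuous_on_eq_continuous_at)
  then show ?thesis
    using that by (auto simp: has_real_derivative_iff_has_vector_derivative)
qed

lemma restoring_antiderivative:
  assumes "restoring f"
  obtains F where "\<And>x. (F has_real_derivative f x) (at x)"
  using continuous_antiderivative assms unfolding restoring_def by blast

lemma potential_strict_mono:
  assumes f: "restoring f" and F: "\<And>x. (F has_real_derivative f x) (at x)"
  shows "0 \<le> a \<Longrightarrow> a < b \<Longrightarrow> F a < F b"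
    and "a < b \<Longrightarrow> b \<le> 0 \<Longrightarrow> F b < F a"
proof -
  have cont: "continuous_on {a..b} F"
    using F DERIV_isCont continuous_at_imp_continuous_on by blast
  show "F a < F b" if "0 \<le> a" "a < b"
  proof (rule DERIV_pos_imp_increasing_open[OF \<open>a < b\<close> _ cont])
    fix x assume "a < x" "x < b"
    then have "f x > 0"
      using f that unfolding restoring_def
      by (metis less_le_not_le order.strict_trans1 zero_less_mult_pos)
    then show "\<exists>y. (F has_real_derivative y) (at x) \<and> 0 < y"
      using F by blast
  qed
  show "F b < F a" if "a < b" "b \<le> 0"
  proof (rule DERIV_neg_imp_decreasing_open[OF \<open>a < b\<close> _ cont])
    fix x assume "a < x" "x < b"
    then have "x < 0" using that by simp
    then have "f x < 0"
      using f unfolding restoring_def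
      by (metis less_irrefl less_asym zero_less_mult_iff)
    then show "\<exists>y. (F has_real_derivative y) (at x) \<and> y < 0"
      using F by blast
  qed
qed

text \<open>
  On either half-line the potential is injective: the energy leaves only the sign of the
  variable undetermined.
\<close>
lemma potential_inj:
  assumes "restoring f" and "\<And>x. (F has_real_derivative f x) (at x)"
    and "F a = F b" and "a * b > 0"
  shows "a = b"
  using potential_strict_mono[OF assms(1,2), of a b] potential_strict_mono[OF assms(1,2), of b a]
    assms(3,4) by (fastforce simp: zero_less_mult_iff)

lemma potential_min:
  assumes "restoring f" and "\<And>x. (F has_real_derivative f x) (at x)"
  shows "F 0 \<le> F x" and "F x = F 0 \<longleftrightarrow> x = 0"
  using potential_strict_mono[OF assms, of 0 x] potential_strict_mono[OF assms, of x 0]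
  by (cases x "0::real" rule: linorder_cases; fastforce)+

section \<open>The Hamiltonian system\<close>

lemma energy_conserved:
  assumes "H_solution f g x y"
    and F: "\<And>x. (F has_real_derivative f x) (at x)"
    and G: "\<And>x. (G has_real_derivative g x) (at x)"
  shows "2 * F (x s) + G (y s) = 2 * F (x t) + G (y t)"
proof -
  have "((\<lambda>t. 2 * F (x t) + G (y t)) has_real_derivative 0) (at t)" for t
  proof -
    have x: "(x has_real_derivative - g (y t)) (at t)"
      and y: "(y has_real_derivative 2 * f (x t)) (at t)"
      using assms(1) by (auto simp: H_solution_def)
    show ?thesis
      by (rule derivative_eq_intros DERIV_chain2[OF F x] DERIV_chain2[OF G y] refl)+ simp
  qed
  then show ?thesis
    using DERIV_isconst_all[of "\<lambda>t. 2 * F (x t) + G (y t)"] by blast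
qed

lemma H_solution_continuous:
  assumes "H_solution f g x y"
  shows "continuous_on S x" "continuous_on S y"
  using assms unfolding H_solution_def
  by (meson DERIV_isCont continuous_at_imp_continuous_on)+

text \<open>
  The origin is the strict minimum of the energy, so a solution that visits it stays there.
\<close>
lemma H_solution_nonzero:
  assumes f: "restoring f" and g: "restoring g" and sol: "H_solution f g x y"
    and nz: "(x s, y s) \<noteq> (0, 0)"
  shows "(x t, y t) \<noteq> (0, 0)"
proof
  assume z: "(x t, y t) = (0, 0)"
  obtain F where F: "\<And>x. (F has_real_derivative f x) (at x)"
    using restoring_antiderivative[OF f] by blast
  obtain G where G: "\<And>x. (G has_real_derivative g x) (at x)"
    using restoring_antiderivative[OF g] by blast
  have "2 * F (x s) + G (y s) = 2 * F 0 + G 0"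
    using energy_conserved[OF sol F G, of s t] z by simp
  then have "F (x s) = F 0" "G (y s) = G 0"
    using potential_min(1)[OF f F, of "x s"] potential_min(1)[OF g G, of "y s"] by linarith+
  then show False
    using nz potential_min(2)[OF f F] potential_min(2)[OF g G] by simp
qed

text \<open>
  Rotating the plane by a right angle exchanges the roles of the two variables and gives a
  system of the same form; the factor 1/2 compensates for the factor 2 that the form of the
  system puts in front of its first force. Through this, whatever is proved where \<open>y \<noteq> 0\<close> also
  holds where \<open>x \<noteq> 0\<close>.
\<close>
lemma H_solution_quarter_turn:
  assumes "restoring f" "H_solution f g x y"
  shows "H_solution (\<lambda>u. (1/2) * g u) (\<lambda>u. 2 * f u) y (\<lambda>t. - x t)"
  using assms unfolding H_solution_def
  by (auto simp: restoring_odd intro!: derivative_eq_intros)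

text \<open>
  Reversing time changes the sign of the vector field. Its first component is odd in \<open>y\<close> and its
  second does not depend on \<open>y\<close>, so a change of sign of \<open>y\<close> compensates for the reversal.
\<close>
lemma H_solution_reflect_y:
  assumes "restoring g" "H_solution f g x y"
  shows "H_solution f g (\<lambda>t. x (c - t)) (\<lambda>t. - y (c - t))"
  unfolding H_solution_def
proof (intro allI conjI)
  fix t
  have d: "((\<lambda>t. c - t) has_real_derivative -1) (at t)"
    by (auto intro!: derivative_eq_intros)
  have x: "(x has_real_derivative - g (y (c - t))) (at (c - t))"
    and y: "(y has_real_derivative 2 * f (x (c - t))) (at (c - t))"
    using assms(2) by (auto simp: H_solution_def)
  show "((\<lambda>t. x (c - t)) has_real_derivative - g (- y (c - t))) (at t)"
    using DERIV_chain2[OF x d] by (simp add: restoring_odd[OF assms(1)])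
  show "((\<lambda>t. - y (c - t)) has_real_derivative 2 * f (x (c - t))) (at t)"
    using DERIV_minus[OF DERIV_chain2[OF y d]] by simp
qed

lemma H_solution_uminus:
  assumes "restoring f" "restoring g" "H_solution f g x y"
  shows "H_solution f g (\<lambda>t. - x t) (\<lambda>t. - y t)"
  using assms unfolding H_solution_def
  by (auto simp: restoring_odd intro!: derivative_eq_intros)

lemma H_solution_reflect_x:
  assumes "restoring f" "restoring g" "H_solution f g x y"
  shows "H_solution f g (\<lambda>t. - x (c - t)) (\<lambda>t. y (c - t))"
  using H_solution_uminus[OF assms(1,2) H_solution_reflect_y[OF assms(2,3)], of c] by simp

section \<open>Uniqueness away from the origin\<close>

text \<open>
  Near \<open>s\<close> the first component \<open>x1\<close> is strictly monotone, so there is a local time change \<open>\<tau>\<close> with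
  \<open>x1 (\<tau> t) = x2 t\<close>. Equal energies and equal signs then give \<open>y1 (\<tau> t) = y2 t\<close>, so both
  solutions move with the same velocity at corresponding times. Hence \<open>\<tau>' = 1\<close>, and since
  \<open>\<tau> s = s\<close>, the time change is the identity.
\<close>
lemma H_solution_unique_near_y_nonzero:
  assumes f: "restoring f" and g: "restoring g"
    and sol1: "H_solution f g x1 y1" and sol2: "H_solution f g x2 y2"
    and eq: "x1 s = x2 s" "y1 s = y2 s" and nz: "y1 s \<noteq> 0"
  shows "\<forall>\<^sub>F t in nhds s. x1 t = x2 t \<and> y1 t = y2 t"
proof -
  obtain F where F: "\<And>x. (F has_real_derivative f x) (at x)"
    using restoring_antiderivative[OF f] by blast
  obtain G where G: "\<And>x. (G has_real_derivative g x) (at x)"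
    using restoring_antiderivative[OF g] by blast
  have energy: "2 * F (x1 t) + G (y1 t) = 2 * F (x2 t') + G (y2 t')" for t t'
    using energy_conserved[OF sol1 F G, of t s] energy_conserved[OF sol2 F G, of t' s] eq by simp
  have cont: "isCont y1 t" "isCont y2 t" "isCont x2 t" for t
    using H_solution_continuous[OF sol1, of UNIV] H_solution_continuous[OF sol2, of UNIV]
    by (auto simp: continuous_on_eq_continuous_at)
  have D1: "(x1 has_real_derivative - g (y1 t)) (at t)" for t
    using sol1 by (auto simp: H_solution_def)
  have D2: "(x2 has_real_derivative - g (y2 t)) (at t)" for t
    using sol2 by (auto simp: H_solution_def)
  \<comment> \<open>The product with \<open>y1 s\<close> treats both signs of \<open>y1 s\<close> at once.\<close>
  have pos: "y1 s * y1 s > 0" "y2 s * y1 s > 0"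
    using nz eq by (simp_all add: zero_less_mult_iff linorder_neq_iff disj_commute)
  have "((\<lambda>t. y1 t * y1 s) \<longlongrightarrow> y1 s * y1 s) (nhds s)" "((\<lambda>t. y2 t * y1 s) \<longlongrightarrow> y2 s * y1 s) (nhds s)"
    using cont by (auto intro!: tendsto_intros simp: isCont_def tendsto_at_iff_tendsto_nhds)
  then have ev: "\<forall>\<^sub>F t in nhds s. y1 t * y1 s > 0" "\<forall>\<^sub>F t in nhds s. y2 t * y1 s > 0"
    using pos order_tendstoD(1) by blast+
  then obtain d where d: "d > 0" "\<And>t. dist t s < d \<Longrightarrow> y1 t * y1 s > 0"
    unfolding eventually_nhds_metric by blast
  define S where "S = ball s d"
  have S: "open S" "s \<in> S" "is_interval S" "\<And>t. t \<in> S \<Longrightarrow> y1 t * y1 s > 0"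
    using d by (auto simp: S_def dist_commute is_interval_ball_real)
  have no_turn: "x1 a \<noteq> x1 b" if "a \<in> S" "b \<in> S" "a < b" for a b
  proof
    assume "x1 a = x1 b"
    then obtain z where z: "a < z" "z < b" "x1 b - x1 a = (b - a) * - g (y1 z)"
      using MVT2[OF \<open>a < b\<close>, of x1 "\<lambda>t. - g (y1 t)"] D1 by blast
    then have "y1 z = 0"
      using \<open>x1 a = x1 b\<close> \<open>a < b\<close> restoring_eq_0_iff[OF g] by simp
    moreover have "z \<in> S"
      using S(3) that z by (meson mem_is_interval_1_I less_imp_le)
    ultimately show False using S(4) by fastforce
  qed
  have inj: "inj_on x1 S"
    by (metis inj_onI linorder_neqE no_turn)
  have cont1: "continuous_on S x1"
    by (rule H_solution_continuous(1)[OF sol1])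
  have "open (x1 ` S)"
    using injective_eq_1d_open_map_UNIV[OF cont1 S(3)] inj S(1) by blast
  define h where "h = inv_into S x1"
  have h: "h (x1 t) = t" if "t \<in> S" for t
    using inj that by (simp add: h_def)
  have Dh: "(h has_real_derivative inverse (- g (y1 t))) (at (x1 t))" if "t \<in> S" for t
    unfolding has_field_derivative_def
  proof (rule has_derivative_inverse_strong[of S t x1])
    show "(x1 has_derivative (*) (- g (y1 t))) (at t)"
      using D1[of t] unfolding has_field_derivative_def .
    have "g (y1 t) \<noteq> 0"
      using S(4)[OF that] by (auto simp: restoring_eq_0_iff[OF g])
    then show "(*) (- g (y1 t)) \<circ> (*) (inverse (- g (y1 t))) = id"
      by (simp add: fun_eq_iff mult.assoc[symmetric])
  qed (fact S(1) that cont1 h)+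
  have "\<forall>\<^sub>F t in nhds s. x2 t \<in> x1 ` S"
  proof (rule topological_tendstoD)
    show "(x2 \<longlongrightarrow> x2 s) (nhds s)"
      using cont by (auto simp: isCont_def tendsto_at_iff_tendsto_nhds)
    show "x2 s \<in> x1 ` S" using S(2) eq by (metis imageI)
  qed fact
  then have "\<forall>\<^sub>F t in nhds s. x2 t \<in> x1 ` S \<and> y2 t * y1 s > 0"
    using ev(2) by (rule eventually_conj)
  then obtain e where e: "e > 0" "\<And>t. dist t s < e \<Longrightarrow> x2 t \<in> x1 ` S \<and> y2 t * y1 s > 0"
    unfolding eventually_nhds_metric by blast
  \<comment> \<open>The time change \<open>\<tau>\<close> is \<open>h \<circ> x2\<close>.\<close>
  have \<tau>: "h (x2 t) \<in> S" "x1 (h (x2 t)) = x2 t" "y1 (h (x2 t)) = y2 t" if "dist t s < e" for t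
  proof -
    show m: "h (x2 t) \<in> S" and x: "x1 (h (x2 t)) = x2 t"
      using e(2)[OF that] by (simp_all add: h_def inv_into_into f_inv_into_f)
    have "y1 (h (x2 t)) * y2 t > 0"
      using S(4)[OF m] e(2)[OF that] by (auto simp: zero_less_mult_iff)
    moreover have "G (y1 (h (x2 t))) = G (y2 t)"
      using energy[of "h (x2 t)" t] x by simp
    ultimately show "y1 (h (x2 t)) = y2 t"
      using potential_inj[OF g G] by blast
  qed
  have const: "((\<lambda>t. h (x2 t) - t) has_real_derivative 0) (at t)" if "dist t s < e" for t
  proof -
    have "g (y2 t) \<noteq> 0"
      using e(2)[OF that] by (auto simp: restoring_eq_0_iff[OF g])
    moreover have "(h has_real_derivative inverse (- g (y2 t))) (at (x2 t))"
      using Dh[OF \<tau>(1)[OF that]] \<tau>(2,3)[OF that] by simp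
    ultimately show ?thesis
      using DERIV_diff[OF DERIV_chain2[OF _ D2] DERIV_ident] by fastforce
  qed
  have "x1 t = x2 t \<and> y1 t = y2 t" if "dist t s < e" for t
  proof -
    have "h (x2 t) - t = h (x2 s) - s"
      by (rule DERIV_isconst3[of "s - e" "s + e"])
        (use const that \<open>e > 0\<close> in \<open>auto simp: dist_real_def\<close>)
    then have "h (x2 t) = t"
      using h[OF S(2)] eq by simp
    then show ?thesis using \<tau>[OF that] by simp
  qed
  then show ?thesis
    using \<open>e > 0\<close> unfolding eventually_nhds_metric by blast
qed

text \<open>
  The times at which the two solutions agree form a closed set, and local uniqueness makes it
  open because neither solution ever reaches the origin.
\<close>
theorem H_solution_unique:
  assumes f: "restoring f" and g: "restoring g"
    and sol1: "H_solution f g x1 y1" and sol2: "H_solution f g x2 y2"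
    and eq: "x1 s = x2 s" "y1 s = y2 s" and nz: "(x1 s, y1 s) \<noteq> (0, 0)"
  shows "x1 t = x2 t" "y1 t = y2 t"
proof -
  let ?A = "{t. x1 t = x2 t \<and> y1 t = y2 t}"
  have "\<forall>\<^sub>F u in nhds t. u \<in> ?A" if "t \<in> ?A" for t
  proof (cases "y1 t = 0")
    case False
    then show ?thesis
      using H_solution_unique_near_y_nonzero[OF f g sol1 sol2, of t] that by simp
  next
    case True
    then have "x1 t \<noteq> 0"
      using H_solution_nonzero[OF f g sol1 nz, of t] by simp
    then have "\<forall>\<^sub>F u in nhds t. y1 u = y2 u \<and> - x1 u = - x2 u"
      using that
      by (intro H_solution_unique_near_y_nonzero[OF restoring_scale[OF g] restoring_scale[OF f]
            H_solution_quarter_turn[OF f sol1] H_solution_quarter_turn[OF f sol2]]) auto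
    then show ?thesis by eventually_elim simp
  qed
  then have "\<exists>T. open T \<and> t \<in> T \<and> T \<subseteq> ?A" if "t \<in> ?A" for t
    using that unfolding eventually_nhds by (simp only: subset_iff Ball_def)
  then have "open ?A"
    using open_subopen[of ?A] by blast
  moreover have "closed ?A"
    using H_solution_continuous[OF sol1] H_solution_continuous[OF sol2]
    by (intro closed_Collect_conj closed_Collect_eq)
  ultimately have "?A = {} \<or> ?A = UNIV"
    by (intro clopen[THEN iffD1] conjI)
  moreover have "s \<in> ?A" using eq by simp
  ultimately have "t \<in> ?A" by (metis UNIV_I empty_iff)
  then show "x1 t = x2 t" "y1 t = y2 t" by simp_all
qed

section \<open>Periods and antiperiods\<close>

lemma periodic_int_multiple:
  fixes k :: int
  assumes p: "\<And>t. u (t + p) = u (t::real)"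
  shows "u (t + of_int k * p) = u t"
proof (induction k arbitrary: t rule: int_induct[where k = 0])
  case base
  then show ?case by simp
next
  case (step1 i)
  then show ?case
    using p[of "t + of_int i * p"] by (simp add: algebra_simps)
next
  case (step2 i)
  then show ?case
    using p[of "t + of_int (i - 1) * p"] by (simp add: algebra_simps)
qed

lemma period_multiple_of_minimal_period:
  assumes "minimal_period u p" and q: "\<And>t. u (t + q) = u t"
  obtains k :: int where "q = of_int k * p"
proof -
  have "p > 0" and p: "\<And>t. u (t + p) = u t"
    and min: "\<And>r. 0 < r \<Longrightarrow> r < p \<Longrightarrow> \<not> (\<forall>t. u (t + r) = u t)"
    using assms(1) by (auto simp: minimal_period_def)
  define k where "k = \<lfloor>q / p\<rfloor>"
  define r where "r = q - of_int k * p"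
  have "0 \<le> r" "r < p"
    using \<open>p > 0\<close> floor_divide_lower[of p q] floor_divide_upper[of p q]
    by (auto simp: r_def k_def algebra_simps)
  moreover have "u (t + r) = u t" for t
    using periodic_int_multiple[of u p "t + r" k] p q[of t] by (simp add: r_def)
  ultimately have "r = 0"
    using min[of r] by fastforce
  then show ?thesis
    using that[of k] by (simp add: r_def)
qed

text \<open>
  Twice an antiperiod \<open>S\<close> is a period, so \<open>S\<close> is an integer multiple \<open>k\<close> of the half period 1.
  If \<open>k\<close> were even, \<open>S\<close> would itself be a period, which is impossible without zeros. For odd \<open>k\<close>,
  shifts by \<open>S\<close> and by 1 differ by a period.
\<close>
lemma half_period_antiperiodic:
  fixes u :: "real \<Rightarrow> real \<times> real"
  assumes min: "minimal_period u 2" and anti: "\<And>t. u (t + S) = - u t" and nz: "\<And>t. u t \<noteq> 0"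
  shows "u (t + 1) = - u t"
proof -
  have "u (t + 2 * S) = u t" for t
    using anti[of t] anti[of "t + S"] by (simp add: algebra_simps)
  then obtain k where "2 * S = of_int k * 2"
    using period_multiple_of_minimal_period[OF min] by blast
  then have S: "S = of_int k" by simp
  have p: "\<And>t. u (t + 2) = u t"
    using min by (auto simp: minimal_period_def)
  have per: "u (t + of_int j * 2) = u t" for t j
    by (rule periodic_int_multiple[of u 2, OF p])
  show ?thesis
  proof (cases "even k")
    case True
    then obtain j where "k = 2 * j" by blast
    then have "u 0 = - u 0"
      using anti[of 0] per[of 0 j] S by (simp add: mult.commute)
    then have "u 0 = 0"
      by (simp add: prod_eq_iff)
    then show ?thesis using nz by simp
  next
    case False
    then obtain j where "k = 2 * j + 1" using oddE by blast
    then show ?thesis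
      using anti[of t] per[of "t + 1" j] S by (simp add: algebra_simps)
  qed
qed

lemma periodic_derivative_zero:
  fixes u :: "real \<Rightarrow> real"
  assumes "\<And>t. (u has_real_derivative u' t) (at t)" and "u (s + p) = u s" and "p > 0"
  obtains t where "u' t = 0"
proof -
  obtain z where "u (s + p) - u s = (s + p - s) * u' z"
    using MVT2[of s "s + p" u u'] assms by auto
  then show ?thesis using that assms by simp
qed

section \<open>Half-period symmetry of Hamiltonian solutions\<close>

text \<open>
  The composition of the reversals about \<open>a\<close> and \<open>b\<close> is the shift by \<open>2 * (a - b)\<close>, while the two
  reflections of the plane compose to \<open>- id\<close>.
\<close>
lemma H_periodic_solution_antiperiodic:
  assumes f: "restoring f" and g: "restoring g" and "H_periodic_solution f g 2 x y"
  shows "x (t + 1) = - x t" "y (t + 1) = - y t"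
proof -
  have sol: "H_solution f g x y" and min: "minimal_period (\<lambda>t. (x t, y t)) 2"
    using assms(3) by (auto simp: H_periodic_solution_def)
  have Dx: "\<And>t. (x has_real_derivative - g (y t)) (at t)"
    and Dy: "\<And>t. (y has_real_derivative 2 * f (x t)) (at t)"
    using sol by (auto simp: H_solution_def)
  have per: "x (t + 2) = x t" "y (t + 2) = y t" for t
    using min by (auto simp: minimal_period_def)
  \<comment> \<open>The zero solution would have period 1.\<close>
  have "\<not> (\<forall>t. (x (t + 1), y (t + 1)) = (x t, y t))"
    using min unfolding minimal_period_def by (meson one_less_numeral_iff semiring_norm(76) zero_less_one)
  then obtain s where "(x s, y s) \<noteq> (0, 0)"
    by metis
  then have nz: "(x t, y t) \<noteq> (0, 0)" for t
    by (rule H_solution_nonzero[OF f g sol])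
  obtain b where "- g (y b) = 0"
    using periodic_derivative_zero[of x "\<lambda>t. - g (y t)", OF Dx per(1)] by auto
  then have b: "y b = 0" using restoring_eq_0_iff[OF g] by simp
  obtain a where "2 * f (x a) = 0"
    using periodic_derivative_zero[of y "\<lambda>t. 2 * f (x t)", OF Dy per(2)] by auto
  then have a: "x a = 0" using restoring_eq_0_iff[OF f] by simp
  have ra: "x t = - x (2 * a - t)" "y t = y (2 * a - t)" for t
    using H_solution_unique[OF f g sol H_solution_reflect_x[OF f g sol, of "2 * a"] _ _ nz, of a t] a
    by simp_all
  have rb: "x t = x (2 * b - t)" "y t = - y (2 * b - t)" for t
    using H_solution_unique[OF f g sol H_solution_reflect_y[OF g sol, of "2 * b"] _ _ nz, of b t] b
    by simp_all
  have "(x (t + 2 * (a - b)), y (t + 2 * (a - b))) = - (x t, y t)" for t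
    using ra[of "t + 2 * (a - b)"] rb[of t] by (simp add: algebra_simps)
  then have "(x (t + 1), y (t + 1)) = - (x t, y t)"
    by (rule half_period_antiperiodic[OF min]) (use nz in \<open>simp add: zero_prod_def\<close>)
  then show "x (t + 1) = - x t" "y (t + 1) = - y t" by simp_all
qed

section \<open>The delay equation\<close>

lemma delay_integral_eq:
  fixes \<Phi> :: "real \<Rightarrow> real"
  assumes "\<And>t. (\<Phi> has_real_derivative \<phi> t) (at t)"
  shows "integral {0..1} (\<lambda>s. \<phi> (t - s)) = \<Phi> t - \<Phi> (t - 1)"
proof -
  have "((\<lambda>s. \<Phi> (t - s)) has_real_derivative \<phi> (t - s) * - 1) (at s)" for s
    by (rule DERIV_chain2[OF assms]) (auto intro!: derivative_eq_intros)
  from DERIV_minus[OF this] have "((\<lambda>s. - \<Phi> (t - s)) has_real_derivative \<phi> (t - s)) (at s)" for s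
    by simp
  then have "((\<lambda>s. \<phi> (t - s)) has_integral - \<Phi> (t - 1) - - \<Phi> (t - 0)) {0..1}"
    by (intro fundamental_theorem_of_calculus)
      (auto simp: has_real_derivative_iff_has_vector_derivative intro: has_vector_derivative_at_within)
  then show ?thesis by (auto dest: integral_unique)
qed

lemma SSPS_imp_H_periodic_solution:
  assumes f: "restoring f" and "SSPS f g x"
  shows "H_periodic_solution f g 2 x (\<lambda>t. integral {0..1} (\<lambda>s. f (x (t - s))))"
proof -
  let ?y = "\<lambda>t. integral {0..1} (\<lambda>s. f (x (t - s)))"
  have Dx: "\<And>t. (x has_real_derivative - g (?y t)) (at t)"
    and min: "minimal_period x 2" and anti: "\<And>t. x (t - 1) = - x t"
    using assms(2) by (auto simp: SSPS_def D_solution_def add_eq_0_iff)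
  have "continuous_on UNIV (\<lambda>t. f (x t))"
  proof (rule continuous_on_compose2[of UNIV f])
    show "continuous_on UNIV x"
      using Dx DERIV_isCont continuous_at_imp_continuous_on by blast
  qed (use f in \<open>auto simp: restoring_def\<close>)
  then obtain \<Phi> where \<Phi>: "\<And>t. (\<Phi> has_real_derivative f (x t)) (at t)"
    using continuous_antiderivative by blast
  have "((\<lambda>t. \<Phi> t - \<Phi> (t - 1)) has_real_derivative 2 * f (x t)) (at t)" for t
  proof -
    have "((\<lambda>t. \<Phi> (t - 1)) has_real_derivative f (x (t - 1)) * 1) (at t)"
      by (rule DERIV_chain2[OF \<Phi>]) (auto intro!: derivative_eq_intros)
    from DERIV_diff[OF \<Phi> this] show ?thesis
      using anti restoring_odd[OF f] by simp
  qed
  then have "(?y has_real_derivative 2 * f (x t)) (at t)" for t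
    using delay_integral_eq[OF \<Phi>] by simp
  moreover have "minimal_period (\<lambda>t. (x t, ?y t)) 2"
    unfolding minimal_period_def
  proof (intro conjI allI impI)
    have per: "x (t + 2) = x t" for t
      using min by (simp add: minimal_period_def)
    show "(x (t + 2), ?y (t + 2)) = (x t, ?y t)" for t
      using per[of t] per[of "t - _"] by (simp add: algebra_simps)
    show "\<not> (\<forall>t. (x (t + q), ?y (t + q)) = (x t, ?y t))" if "0 < q \<and> q < 2" for q
      using min that unfolding minimal_period_def by blast
  qed simp
  ultimately show ?thesis
    using Dx by (simp add: H_periodic_solution_def H_solution_def)
qed

lemma H_periodic_solution_imp_SSPS:
  assumes f: "restoring f" and g: "restoring g" and per: "H_periodic_solution f g 2 x y"
  shows "SSPS f g x"
  unfolding SSPS_def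
proof (intro conjI allI)
  have sol: "H_solution f g x y" and min: "minimal_period (\<lambda>t. (x t, y t)) 2"
    using per by (auto simp: H_periodic_solution_def)
  have anti: "x (t - 1) = - x t" "y (t - 1) = - y t" for t
    using H_periodic_solution_antiperiodic[OF f g per, of "t - 1"] by simp_all
  show "x t + x (t - 1) = 0" for t
    using anti by simp
  have "integral {0..1} (\<lambda>s. f (x (t - s))) = y t" for t
  proof -
    have "((\<lambda>t. y t / 2) has_real_derivative f (x t)) (at t)" for t
      using sol by (auto simp: H_solution_def intro!: derivative_eq_intros)
    then have "integral {0..1} (\<lambda>s. f (x (t - s))) = y t / 2 - y (t - 1) / 2"
      by (rule delay_integral_eq)
    then show ?thesis using anti by simp
  qed
  then show "D_solution f g x"
    using sol by (simp add: D_solution_def H_solution_def)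
  have Dy: "\<And>t. (y has_real_derivative 2 * f (x t)) (at t)"
    using sol by (auto simp: H_solution_def)
  \<comment> \<open>Every period \<open>q\<close> of \<open>x\<close> is one of \<open>y\<close>: the increment \<open>y (t + q) - y t\<close> is constant in \<open>t\<close>
    since \<open>y'\<close> depends on \<open>x\<close> only, yet it changes sign after time 1.\<close>
  have "y (t + q) = y t" if q: "\<And>t. x (t + q) = x t" for q t
  proof -
    have "((\<lambda>t. y (t + q) - y t) has_real_derivative 0) (at t)" for t
      using DERIV_diff[OF Dy[of "t + q", unfolded DERIV_shift] Dy[of t]] q by simp
    then have "y (t + q) - y t = y (t - 1 + q) - y (t - 1)"
      using DERIV_isconst_all[of "\<lambda>t. y (t + q) - y t"] by blast
    then show ?thesis
      using anti(2)[of t] anti(2)[of "t + q"] by (simp add: algebra_simps)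
  qed
  then show "minimal_period x 2"
    using min unfolding minimal_period_def prod.inject by blast
qed

theorem theorem7:
  fixes f g :: "real \<Rightarrow> real"
  assumes "continuous_on UNIV f" and "continuous_on UNIV g"
    and "\<And>x. f (- x) = - f x" and "\<And>x. g (- x) = - g x"
    and "\<And>x. x \<noteq> 0 \<Longrightarrow> x * f x > 0" and "\<And>x. x \<noteq> 0 \<Longrightarrow> x * g x > 0"
    and "f 0 = 0" and "g 0 = 0"
  shows
    "(\<forall>x. SSPS f g x \<longrightarrow>
        H_periodic_solution f g 2 x (\<lambda>t. integral {0..1} (\<lambda>s. f (x (t - s))))) \<and>
     (\<forall>x y. H_periodic_solution f g 2 x y \<and> around_origin (trajectory x y) \<longrightarrow> SSPS f g x) \<and>
     ((\<exists>x. SSPS f g x) \<longleftrightarrow> (\<exists>C. H_closed_orbit f g 2 C))"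
proof -
  have f: "restoring f" and g: "restoring g"
    using assms by (auto simp: restoring_def)
  show ?thesis
    using SSPS_imp_H_periodic_solution[OF f] H_periodic_solution_imp_SSPS[OF f g]
    unfolding H_closed_orbit_def by blast
qed

end
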